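(* Let $k\ge 1$ be an integer, let $s_1,\dots,s_k$ be positive integers, and let $x_1,\dots,x_k$ be real numbers with $0\le x_j\le 1$ for $1\le j\le k$, such that the series $\mathrm{Li}_{s_1,\dots,s_k}(x_1,\dots,x_k)$ converges. Then $$\mathrm{Li}_{s_1,\dots,s_k}(x_1,\dots,x_k)=\int_{\Delta(\vec s)}\ \prod_{j=1}^k\left\{\tau\bigg(\prod_{m=1}^j x_m u_{s_m}^{(m)}\bigg)\prod_{r=1}^{s_j}\frac{du_r^{(j)}}{u_r^{(j)}}\right\},$$ where $\tau(x):=x/(1-x)$ and $\Delta(\vec s)$ is the set of all tuples of real integration variables $\big(u_r^{(j)}\big)_{1\le j\le k,\ 1\le r\le s_j}$ satisfying $1>u_1^{(j)}>u_2^{(j)}>\cdots>u_{s_j}^{(j)}>0$ for every $j=1,2,\dots,k$.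
   Context: The multiple polylogarithm is defined by the nested series $$\mathrm{Li}_{s_1,\dots,s_k}(z_1,\dots,z_k):=\sum_{n_1>\cdots>n_k>0}\ \prod_{j=1}^k n_j^{-s_j}z_j^{n_j},$$ where the sum is over positive integers $n_1>n_2>\cdots>n_k$. The integral is over a region in $\mathbb{R}^{s_1+\cdots+s_k}$ which is the product of $k$ open simplices, one for each $j$; there is no ordering condition between variables with different superscripts $j$. *)

theory Defs
  imports "HOL-Analysis.Analysis"
begin

definition mpl_indices :: "nat \<Rightarrow> (nat \<Rightarrow> nat) set" where
  "mpl_indices k =
     {n \<in> {1..k} \<rightarrow>\<^sub>E {1..}. \<forall>i\<in>{1..k}. \<forall>j\<in>{1..k}. i < j \<longrightarrow> n j < n i}"

text \<open>
  The nested series is an ordinary series in the largest index \<open>n\<^sub>1\<close>; for each value \<open>N\<close> of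
  \<open>n\<^sub>1\<close> the inner sums over \<open>N > n\<^sub>2 > \<dots> > n\<^sub>k > 0\<close> are finite. Convergence thus means convergence
  of the truncations \<open>n\<^sub>1 \<le> N\<close>, so conditionally convergent cases are included.
\<close>

definition mpl_term ::
  "nat \<Rightarrow> (nat \<Rightarrow> nat) \<Rightarrow> (nat \<Rightarrow> 'a) \<Rightarrow> nat \<Rightarrow> 'a :: {real_normed_field, banach}" where
  "mpl_term k s z N =
     (\<Sum>n | n \<in> mpl_indices k \<and> n 1 = N. \<Prod>j=1..k. z j ^ n j / of_nat (n j) ^ s j)"

definition mpl_converges ::
  "nat \<Rightarrow> (nat \<Rightarrow> nat) \<Rightarrow> (nat \<Rightarrow> 'a :: {real_normed_field, banach}) \<Rightarrow> bool" where
  "mpl_converges k s z \<longleftrightarrow> summable (mpl_term k s z)"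

definition Li ::
  "nat \<Rightarrow> (nat \<Rightarrow> nat) \<Rightarrow> (nat \<Rightarrow> 'a) \<Rightarrow> 'a :: {real_normed_field, banach}" where
  "Li k s z = (\<Sum>N. mpl_term k s z N)"

definition tau :: "real \<Rightarrow> real" where
  "tau x = x / (1 - x)"

text \<open>
  The variable \<open>u\<^sub>r\<close> with superscript \<open>j\<close> is \<open>u (j, r)\<close>; \<open>\<real>\<close> to the power \<open>s\<^sub>1 + \<dots> + s\<^sub>k\<close> is the
  set of extensional functions on \<open>mpl_vars k s\<close>.
\<close>

definition mpl_vars :: "nat \<Rightarrow> (nat \<Rightarrow> nat) \<Rightarrow> (nat \<times> nat) set" where
  "mpl_vars k s = (SIGMA j:{1..k}. {1..s j})"

definition mpl_lborel :: "nat \<Rightarrow> (nat \<Rightarrow> nat) \<Rightarrow> (nat \<times> nat \<Rightarrow> real) measure" where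
  "mpl_lborel k s = (\<Pi>\<^sub>M i\<in>mpl_vars k s. lborel)"

definition Delta :: "nat \<Rightarrow> (nat \<Rightarrow> nat) \<Rightarrow> (nat \<times> nat \<Rightarrow> real) set" where
  "Delta k s =
     {u \<in> mpl_vars k s \<rightarrow>\<^sub>E UNIV.
        \<forall>j\<in>{1..k}. 1 > u (j, 1) \<and> (\<forall>r\<in>{1..<s j}. u (j, r) > u (j, r + 1)) \<and> u (j, s j) > 0}"

end

(*
  Expanding each tau in a geometric series with exponents a_1, ..., a_k >= 1 and collecting the
  powers of x_m u^(m)_{s_m} gives the exponent n_m = a_m + ... + a_k; this is a bijection onto the
  strictly decreasing tuples n_1 > ... > n_k > 0.  All terms are nonnegative, so sum and integral
  may be interchanged.  In each summand the variables are integrated out one at a time, the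
  smallest of a simplex first: every integration of u^(n-1) over 0 < u < b produces b^n / n.
*)
theory Submission
  imports Defs
begin

section \<open>Weighted chains: one simplex together with its measure du/u\<close>

text \<open>
  The convention \<open>u\<^sub>0 = 1\<close> lets the constraint \<open>u\<^sub>1 < 1\<close> be treated like \<open>u\<^sub>i < u\<^sub>i\<^sub>-\<^sub>1\<close>, and makes
  the empty chain available as the base case of the iterated integration.
\<close>

definition chain_bound :: "(nat \<Rightarrow> real) \<Rightarrow> nat \<Rightarrow> real" where
  "chain_bound v r = (if r = 0 then 1 else v r)"

text \<open>This is the weight of the measure du_1/u_1 ... du_r/u_r with the indicator of one open
  simplex absorbed. The ordering conditions are attached factor by factor, so the last variable
  occurs in the last factor only and can be split off.\<close>

definition chain_density :: "nat \<Rightarrow> (nat \<Rightarrow> real) \<Rightarrow> real" where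
  "chain_density r v =
     (\<Prod>i=1..r. if 0 < v i \<and> v i < chain_bound v (i - 1) then 1 / v i else 0)"

lemma chain_density_0 [simp]: "chain_density 0 v = 1"
  by (simp add: chain_density_def)

lemma chain_density_Suc:
  "chain_density (Suc r) v =
     chain_density r v *
       (if 0 < v (Suc r) \<and> v (Suc r) < chain_bound v r then 1 / v (Suc r) else 0)"
  by (simp add: chain_density_def)

lemma chain_density_nonneg: "chain_density r v \<ge> 0"
  unfolding chain_density_def by (intro prod_nonneg) auto

lemma chain_density_cong:
  assumes "\<And>i. i \<in> {1..r} \<Longrightarrow> v i = w i"
  shows "chain_density r v = chain_density r w"
  unfolding chain_density_def
proof (intro prod.cong refl)
  fix i assume i: "i \<in> {1..r}"
  hence "chain_bound v (i - 1) = chain_bound w (i - 1)"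
    proof (cases "i = 1")
    case False
    hence "i - 1 \<in> {1..r}" using i by auto
    from assms[OF this] show ?thesis using False i by (simp add: chain_bound_def)
  qed (simp add: chain_bound_def)
  thus "(if 0 < v i \<and> v i < chain_bound v (i - 1) then 1 / v i else 0) =
        (if 0 < w i \<and> w i < chain_bound w (i - 1) then 1 / w i else 0)"
    using assms[OF i] by simp
qed

text \<open>The function update is the shape in which an insertion step of a finite product measure
  presents the integrand; the shorter chain does not see the updated variable.\<close>

lemma chain_density_fun_upd:
  "chain_density (Suc r) (v(Suc r := y)) =
     chain_density r v * (if 0 < y \<and> y < chain_bound v r then 1 / y else 0)"
proof -
  have "chain_density r (v(Suc r := y)) = chain_density r v"
    by (rule chain_density_cong) auto
  moreover have "chain_bound (v(Suc r := y)) r = chain_bound v r"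
    by (auto simp: chain_bound_def)
  ultimately show ?thesis by (simp add: chain_density_Suc)
qed

lemma chain_density_neq_0D:
  assumes "chain_density r v \<noteq> 0" "i \<in> {1..r}"
  shows "0 < v i \<and> v i < chain_bound v (i - 1)"
  using assms by (auto simp: chain_density_def split: if_splits)

lemma chain_bound_pos:
  assumes "chain_density r v \<noteq> 0"
  shows "0 < chain_bound v r"
  using chain_density_neq_0D[OF assms, of r] by (auto simp: chain_bound_def)

lemma measurable_component_lborel:
  assumes "p \<in> A"
  shows "(\<lambda>u. u p) \<in> borel_measurable (Pi\<^sub>M A (\<lambda>_. lborel :: real measure))"
  using measurable_component_singleton[OF assms, of "\<lambda>_. lborel :: real measure"] by simp

lemma measurable_chain_bound:
  assumes "\<And>i. i \<in> {1..r} \<Longrightarrow> (j, i) \<in> A"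
  shows "(\<lambda>u. chain_bound (\<lambda>i. u (j, i)) r) \<in> borel_measurable (Pi\<^sub>M A (\<lambda>_. lborel))"
  using assms measurable_component_lborel[of "(j, r)" A] by (cases r) (auto simp: chain_bound_def)

lemma measurable_chain_density:
  assumes "\<And>i. i \<in> {1..r} \<Longrightarrow> (j, i) \<in> A"
  shows "(\<lambda>u. chain_density r (\<lambda>i. u (j, i))) \<in> borel_measurable (Pi\<^sub>M A (\<lambda>_. lborel))"
  using assms
proof (induction r)
  case (Suc r)
  have [measurable]: "(\<lambda>u. u (j, Suc r)) \<in> borel_measurable (Pi\<^sub>M A (\<lambda>_. lborel))"
      "(\<lambda>u. chain_bound (\<lambda>i. u (j, i)) r) \<in> borel_measurable (Pi\<^sub>M A (\<lambda>_. lborel))"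
      "(\<lambda>u. chain_density r (\<lambda>i. u (j, i))) \<in> borel_measurable (Pi\<^sub>M A (\<lambda>_. lborel))"
    using Suc by (auto intro!: measurable_component_lborel measurable_chain_bound)
  show ?case unfolding chain_density_Suc by measurable
qed simp

section \<open>Iterated integration over the simplices\<close>

text \<open>Dividing by y leaves y^(n-1), with antiderivative y^n / n. The condition
  \<open>1 \<le> n\<close> removes the singularity at 0 and makes the lower boundary term
  vanish.\<close>

lemma nn_integral_power_div:
  fixes b :: real
  assumes "0 \<le> b" "1 \<le> n"
  shows "(\<integral>\<^sup>+y. ennreal ((if 0 < y \<and> y < b then 1 / y else 0) * y ^ n) \<partial>lborel) =
           ennreal (b ^ n / n)"
proof -
  obtain m where n: "n = Suc m" using \<open>1 \<le> n\<close> by (cases n) auto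
  \<comment> \<open>The fundamental theorem of calculus is applied on a closed interval, so the two
    endpoints are discarded as a null set.\<close>
  have "AE y in lborel. y \<noteq> 0 \<and> y \<noteq> b"
    using AE_lborel_singleton[of "0::real"] AE_lborel_singleton[of b] by eventually_elim auto
  hence "(\<integral>\<^sup>+y. ennreal ((if 0 < y \<and> y < b then 1 / y else 0) * y ^ n) \<partial>lborel) =
        (\<integral>\<^sup>+y. ennreal (y ^ m) * indicator {0..b} y \<partial>lborel)"
    by (intro nn_integral_cong_AE, elim eventually_mono) (auto simp: n indicator_def)
  also have "\<dots> = ennreal (b ^ n / n - 0 ^ n / n)"
  proof (rule nn_integral_FTC_Icc)
    show "((\<lambda>y. y ^ n / n) has_real_derivative y ^ m) (at y)" for y
      unfolding n by (auto intro!: derivative_eq_intros simp del: of_nat_Suc power_Suc)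
  qed (use assms in auto)
  finally show ?thesis using n by simp
qed

text \<open>The result has the shape of the integrand again: the chain is shorter by one variable,
  the new last bound carries the same power n, and a factor 1/n has come out. Hence the step can be
  repeated.\<close>

lemma nn_integral_chain_step:
  assumes "1 \<le> n"
  shows "(\<integral>\<^sup>+y. ennreal (chain_density (Suc r) (v(Suc r := y)) * y ^ n) \<partial>lborel) =
           ennreal (chain_density r v * chain_bound v r ^ n / n)"
\<comment> \<open>The bound is known to be positive only where the density is nonzero; elsewhere
  both sides are 0.\<close>
proof (cases "chain_density r v = 0")
  case True
  hence "chain_density (Suc r) (v(Suc r := y)) = 0" for y
    using True by (simp add: chain_density_fun_upd)
  thus ?thesis using True by simp
next
  case False
  have "ennreal (chain_density (Suc r) (v(Suc r := y)) * y ^ n) = ennreal (chain_density r v) *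
          ennreal ((if 0 < y \<and> y < chain_bound v r then 1 / y else 0) * y ^ n)" for y
    using chain_density_nonneg[of r v]
    by (auto simp: chain_density_fun_upd ennreal_mult' mult.assoc)
  hence "(\<integral>\<^sup>+y. ennreal (chain_density (Suc r) (v(Suc r := y)) * y ^ n) \<partial>lborel) =
      ennreal (chain_density r v) *
        (\<integral>\<^sup>+y. ennreal ((if 0 < y \<and> y < chain_bound v r then 1 / y else 0) * y ^ n) \<partial>lborel)"
    by (simp only:) (rule nn_integral_cmult, simp)
  also have "\<dots> = ennreal (chain_density r v) * ennreal (chain_bound v r ^ n / n)"
    using chain_bound_pos[OF False] assms by (subst nn_integral_power_div) auto
  finally show ?thesis
    using chain_density_nonneg[of r v] by (simp add: ennreal_mult'[symmetric])
qed

lemma finite_mpl_vars: "finite (mpl_vars k s)"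
  unfolding mpl_vars_def by auto

text \<open>Induction on the total number of variables: each step integrates out the last variable
  of some nonempty chain. The lengths \<open>s j\<close> may be 0, since chains are used up along
  the way; a used-up chain contributes the factor 1 because its bound is 1.\<close>

lemma nn_integral_chains:
  assumes "\<And>j. j \<in> {1..k} \<Longrightarrow> 1 \<le> n j"
  shows "(\<integral>\<^sup>+u. ennreal (\<Prod>j=1..k. chain_density (s j) (\<lambda>r. u (j, r)) *
             chain_bound (\<lambda>r. u (j, r)) (s j) ^ n j) \<partial>mpl_lborel k s) =
         ennreal (\<Prod>j=1..k. 1 / real (n j) ^ s j)"
proof (induction "\<Sum>j=1..k. s j" arbitrary: s)
  case 0
  hence s: "s j = 0" if "j \<in> {1..k}" for j using that by auto
  hence "mpl_vars k s = {}" by (auto simp: mpl_vars_def)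
  with s show ?case
    by (simp add: mpl_lborel_def PiM_empty nn_integral_count_space_finite chain_bound_def)
next
  case (Suc N)
  define G where "G = (\<lambda>s u. \<Prod>j=1..k. chain_density (s j) (\<lambda>r. u (j, r)) *
             chain_bound (\<lambda>r. u (j, r)) (s j) ^ n j)"
  obtain j where j: "j \<in> {1..k}" "s j \<noteq> 0"
    using Suc.hyps(2) by (metis sum.neutral nat.simps(3))
  then obtain r where r: "s j = Suc r" by (cases "s j") auto
  define s' where "s' = s(j := r)"
  have N: "N = (\<Sum>j=1..k. s' j)"
    using Suc.hyps(2) j r sum.remove[of "{1..k}" j s] sum.remove[of "{1..k}" j s']
      sum.cong[of "{1..k} - {j}" "{1..k} - {j}" s s']
    by (simp add: s'_def)
  have vars: "mpl_vars k s = insert (j, Suc r) (mpl_vars k s')" "(j, Suc r) \<notin> mpl_vars k s'"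
    using j r by (auto simp: mpl_vars_def s'_def split: if_splits)
  interpret product_sigma_finite "\<lambda>_ :: nat \<times> nat. lborel :: real measure"
    by standard
  have meas: "G s \<in> borel_measurable (Pi\<^sub>M (mpl_vars k s) (\<lambda>_. lborel))" for s
    unfolding G_def
    by (intro borel_measurable_prod borel_measurable_times borel_measurable_power
        measurable_chain_density measurable_chain_bound) (auto simp: mpl_vars_def)
  have inner: "(\<integral>\<^sup>+y. ennreal (G s (u((j, Suc r) := y))) \<partial>lborel) = ennreal (G s' u) * ennreal (1 / n j)" for u
  proof -
    \<comment> \<open>The contribution of a single chain: only chain \<open>j\<close> depends on the
      variable being integrated, and the others form the constant \<open>c\<close>.\<close>
    define T where "T = (\<lambda>s u j. chain_density (s j) (\<lambda>r. u (j, r)) *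
             chain_bound (\<lambda>r. u (j, r)) (s j) ^ n j)"
    define v where "v = (\<lambda>i. u (j, i))"
    define c where "c = (\<Prod>i\<in>{1..k} - {j}. T s u i)"
    have G: "G s u = T s u j * (\<Prod>i\<in>{1..k} - {j}. T s u i)" for s u
      unfolding G_def T_def using j by (simp add: prod.remove)
    \<comment> \<open>A bound can be negative at an arbitrary point, but then the density is 0 and
      so is the product.\<close>
    have T_nonneg: "0 \<le> T s u i" for i
      using chain_density_nonneg[of "s i" "\<lambda>r. u (i, r)"] chain_bound_pos[of "s i" "\<lambda>r. u (i, r)"]
      by (cases "chain_density (s i) (\<lambda>r. u (i, r)) = 0") (auto simp: T_def)
    hence c: "0 \<le> c" unfolding c_def by (intro prod_nonneg) auto
    have "(\<Prod>i\<in>{1..k} - {j}. T s (u((j, Suc r) := y)) i) = c" for y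
      unfolding c_def T_def by (intro prod.cong refl) auto
    moreover have "T s (u((j, Suc r) := y)) j = chain_density (Suc r) (v(Suc r := y)) * y ^ n j" for y
    proof -
      have "(\<lambda>i. (u((j, Suc r) := y)) (j, i)) = v(Suc r := y)" by (auto simp: v_def)
      thus ?thesis unfolding T_def r by (simp add: chain_bound_def)
    qed
    ultimately have "G s (u((j, Suc r) := y)) = c * (chain_density (Suc r) (v(Suc r := y)) * y ^ n j)" for y
      unfolding G by simp
    hence "(\<integral>\<^sup>+y. ennreal (G s (u((j, Suc r) := y))) \<partial>lborel) =
        ennreal c * (\<integral>\<^sup>+y. ennreal (chain_density (Suc r) (v(Suc r := y)) * y ^ n j) \<partial>lborel)"
      using c
      by (simp only: ennreal_mult', subst nn_integral_cmult) (auto simp: chain_density_fun_upd)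
    also have "\<dots> = ennreal c * ennreal (chain_density r v * chain_bound v r ^ n j / n j)"
      using assms j by (subst nn_integral_chain_step) auto
    also have "\<dots> = ennreal (G s' u) * ennreal (1 / n j)"
    proof -
      have "(\<Prod>i\<in>{1..k} - {j}. T s' u i) = c"
        unfolding c_def T_def s'_def by (intro prod.cong refl) auto
      moreover have "T s' u j = chain_density r v * chain_bound v r ^ n j"
        unfolding T_def s'_def v_def by simp
      ultimately have "G s' u = chain_density r v * chain_bound v r ^ n j * c"
        unfolding G by simp
      thus ?thesis using c
        by (simp add: ennreal_mult'[symmetric] ennreal_mult''[symmetric] mult_ac)
    qed
    finally show ?thesis .
  qed
  have "(\<integral>\<^sup>+u. ennreal (G s u) \<partial>mpl_lborel k s) =
      (\<integral>\<^sup>+u. (\<integral>\<^sup>+y. ennreal (G s (u((j, Suc r) := y))) \<partial>lborel) \<partial>mpl_lborel k s')"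
    unfolding mpl_lborel_def vars(1)
    using meas[of s] vars finite_mpl_vars by (intro product_nn_integral_insert) auto
  also have "\<dots> = (\<integral>\<^sup>+u. ennreal (G s' u) \<partial>mpl_lborel k s') * ennreal (1 / n j)"
    unfolding inner using meas[of s']
    by (subst nn_integral_multc) (auto simp: mpl_lborel_def)
  also have "\<dots> = ennreal (\<Prod>j=1..k. 1 / real (n j) ^ s' j) * ennreal (1 / n j)"
    using Suc.hyps(1)[OF N] unfolding G_def by simp
  also have "\<dots> = ennreal (\<Prod>j=1..k. 1 / real (n j) ^ s j)"
  proof -
    have "(\<Prod>i\<in>{1..k} - {j}. 1 / real (n i) ^ s' i) = (\<Prod>i\<in>{1..k} - {j}. 1 / real (n i) ^ s i)"
      by (intro prod.cong) (auto simp: s'_def)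
    hence "(\<Prod>j=1..k. 1 / real (n j) ^ s' j) * (1 / n j) = (\<Prod>j=1..k. 1 / real (n j) ^ s j)"
      using j r prod.remove[of "{1..k}" j "\<lambda>j. 1 / real (n j) ^ s' j"]
        prod.remove[of "{1..k}" j "\<lambda>j. 1 / real (n j) ^ s j"]
      by (simp add: s'_def)
    thus ?thesis by (simp only: ennreal_mult''[symmetric] divide_nonneg_nonneg zero_le_one of_nat_0_le_iff)
  qed
  finally show ?case unfolding G_def .
qed

section \<open>Summation indices and the geometric expansion\<close>

lemma countable_mpl_indices: "countable (mpl_indices k)"
proof (rule countable_subset)
  show "mpl_indices k \<subseteq> {1..k} \<rightarrow>\<^sub>E {1..}"
    by (auto simp: mpl_indices_def)
qed (intro countable_PiE, auto)

text \<open>The inverse takes differences of consecutive entries, with 0 in place of an entry after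
  the last. Positive summands correspond exactly to strict decrease and a positive last
  entry.\<close>

lemma bij_betw_tail_sums_mpl_indices:
  "bij_betw (\<lambda>a. \<lambda>j\<in>{1..k}. \<Sum>m=j..k. a m) ({1..k} \<rightarrow>\<^sub>E {1..}) (mpl_indices k)"
proof -
  define T where "T = (\<lambda>a. \<lambda>j\<in>{1..k}. \<Sum>m=j..k. a m :: nat)"
  define D where "D = (\<lambda>n. \<lambda>j\<in>{1..k}. n j - (if j < k then n (Suc j) else 0) :: nat)"
  have T_k: "T a k = a k" if "1 \<le> k" for a
    using that by (simp add: T_def)
  have T_step: "T a j = a j + T a (Suc j)" if "1 \<le> j" "j < k" for a j
    using that by (simp add: T_def sum.atLeast_Suc_atMost[of j k])
  have T_arb: "T a j = undefined" if "j \<notin> {1..k}" for a j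
    using that by (simp only: T_def restrict_apply if_False)
  have D_arb: "D n j = undefined" if "j \<notin> {1..k}" for n j
    using that by (simp only: D_def restrict_apply if_False)
  have D_k: "D n k = n k" if "1 \<le> k" for n
    using that by (simp add: D_def)
  have D_step: "D n j = n j - n (Suc j)" if "1 \<le> j" "j < k" for n j
    using that by (simp add: D_def)
  have D_T: "D (T a) = a" if a: "a \<in> {1..k} \<rightarrow>\<^sub>E {1..}" for a
  proof
    fix j
    consider "j \<notin> {1..k}" | "j = k" "1 \<le> k" | "1 \<le> j" "j < k" by fastforce
    thus "D (T a) j = a j"
    proof cases
      case 1
      thus ?thesis using D_arb PiE_arb[OF a] by metis
    next
      case 2
      thus ?thesis using D_k T_k by metis
    next
      case 3
      thus ?thesis using D_step T_step by (metis diff_add_inverse2)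
    qed
  qed
  have index_pos: "1 \<le> n j" if "n \<in> mpl_indices k" "j \<in> {1..k}" for n j
    using that by (auto simp: mpl_indices_def)
  have index_step: "n (Suc j) < n j" if "n \<in> mpl_indices k" "1 \<le> j" "j < k" for n j
  proof -
    have "j \<in> {1..k}" "Suc j \<in> {1..k}" "j < Suc j" using that by auto
    thus ?thesis using that(1) unfolding mpl_indices_def by blast
  qed
  have T_D: "T (D n) = n" if n: "n \<in> mpl_indices k" for n
  proof
    fix j
    have arb: "n j = undefined" if "j \<notin> {1..k}"
      using n that unfolding mpl_indices_def by (blast intro: PiE_arb)
    have eq: "T (D n) j = n j" if "1 \<le> j" "j \<le> k"
      using that(2,1)
    \<comment> \<open>The induction runs downwards from \<open>k\<close>, since a tail sum is
      determined by the next one.\<close>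
    proof (induction rule: inc_induct)
      case base
      thus ?case by (simp only: T_k D_k)
    next
      case (step j)
      have "T (D n) j = (n j - n (Suc j)) + n (Suc j)"
        using step by (simp only: T_step D_step)
      thus ?case using index_step[OF n, of j] step by simp
    qed
    show "T (D n) j = n j"
      using arb eq T_arb[of j "D n"] by (cases "j \<in> {1..k}") auto
  qed
  have T_mem: "T a \<in> mpl_indices k" if a: "a \<in> {1..k} \<rightarrow>\<^sub>E {1..}" for a
  proof -
    have pos: "1 \<le> a j" if "j \<in> {1..k}" for j
      using PiE_mem[OF a that] by simp
    have le: "a j \<le> T a j" if "j \<in> {1..k}" for j
      using that by (auto simp: T_def sum.atLeast_Suc_atMost[of j k])
    have "T a j < T a i" if ij: "i \<in> {1..k}" "j \<in> {1..k}" "i < j" for i j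
    proof -
      have "T a j \<le> T a (Suc i)"
        using ij by (auto simp: T_def intro!: sum_mono2)
      thus ?thesis using T_step[of i a] pos[OF ij(1)] ij by simp
    qed
    moreover have "1 \<le> T a j" if "j \<in> {1..k}" for j
      using le[OF that] pos[OF that] by simp
    moreover have "T a \<in> extensional {1..k}"
      unfolding T_def by (rule restrict_extensional)
    ultimately show ?thesis
      unfolding mpl_indices_def PiE_iff by blast
  qed
  have D_mem: "D n \<in> {1..k} \<rightarrow>\<^sub>E {1..}" if n: "n \<in> mpl_indices k" for n
  proof (rule PiE_I)
    fix j assume j: "j \<in> {1..k}"
    show "D n j \<in> {1..}"
    proof (cases "j = k")
      case True
      thus ?thesis using index_pos[OF n j] D_k[of n] j by simp
    next
      case False
      thus ?thesis using index_step[OF n, of j] D_step[of j n] j by simp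
    qed
  qed (rule D_arb)
  have "bij_betw T ({1..k} \<rightarrow>\<^sub>E {1..}) (mpl_indices k)"
  proof (rule bij_betw_byWitness[where f' = D])
    show "\<forall>a\<in>{1..k} \<rightarrow>\<^sub>E {1..}. D (T a) = a" by (intro ballI D_T)
    show "\<forall>n\<in>mpl_indices k. T (D n) = n" by (intro ballI T_D)
    show "T ` ({1..k} \<rightarrow>\<^sub>E {1..}) \<subseteq> mpl_indices k" by (intro image_subsetI T_mem)
    show "D ` mpl_indices k \<subseteq> {1..k} \<rightarrow>\<^sub>E {1..}" by (intro image_subsetI D_mem)
  qed
  thus ?thesis unfolding T_def .
qed

text \<open>This is the geometric series without its constant term, whence exponents from 1 on. As
  an integral over a counting measure it can be multiplied by the product rule for product
  measures.\<close>

lemma ennreal_tau_geometric: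
  assumes "0 \<le> y" "y < 1"
  shows "ennreal (tau y) = (\<integral>\<^sup>+a. ennreal (y ^ a) \<partial>count_space {1..})"
proof -
  have "bij_betw Suc UNIV {1..}"
    by (rule bij_betw_byWitness[where f' = "\<lambda>n. n - 1"]) auto
  hence "(\<integral>\<^sup>+a. ennreal (y ^ a) \<partial>count_space {1..}) =
         (\<integral>\<^sup>+a. ennreal (y ^ Suc a) \<partial>count_space UNIV)"
    by (rule nn_integral_bij_count_space[symmetric])
  also have "\<dots> = (\<Sum>a. ennreal (y ^ Suc a))"
    by (rule nn_integral_count_space_nat)
  also have "\<dots> = ennreal (y * (1 / (1 - y)))"
  proof (rule suminf_ennreal_eq)
    show "(\<lambda>a. y ^ Suc a) sums (y * (1 / (1 - y)))"
      unfolding power_Suc using assms by (intro sums_mult geometric_sums) auto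
  qed (use assms in auto)
  finally show ?thesis by (simp add: tau_def)
qed

text \<open>A product of \<open>k\<close> geometric series is one sum over exponent tuples
  \<open>a\<close>. The variable \<open>z m\<close> occurs in the series for every j with m \<le> j,
  so it collects the tail sum of \<open>a\<close> from m, and the tail-sum bijection reindexes the
  sum.\<close>

lemma prod_tau_expansion:
  assumes nonneg: "\<And>j. j \<in> {1..k} \<Longrightarrow> 0 \<le> z j"
    and less: "\<And>j. j \<in> {1..k} \<Longrightarrow> (\<Prod>m=1..j. z m) < 1"
  shows "ennreal (\<Prod>j=1..k. tau (\<Prod>m=1..j. z m)) =
           (\<integral>\<^sup>+n. ennreal (\<Prod>j=1..k. z j ^ n j) \<partial>count_space (mpl_indices k))"
proof -
  define y where "y = (\<lambda>j. \<Prod>m=1..j. z m)"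
  have y: "0 \<le> y j" "y j < 1" if "j \<in> {1..k}" for j
    using that nonneg less unfolding y_def by (auto intro!: prod_nonneg)
  interpret product_sigma_finite "\<lambda>_ :: nat. count_space {1 :: nat..}"
    by (intro product_sigma_finite.intro sigma_finite_measure_count_space_countable) auto
  have regroup: "(\<Prod>j=1..k. y j ^ a j) = (\<Prod>m=1..k. z m ^ (\<Sum>j=m..k. a j))" for a
  proof -
    have "(\<Prod>j=1..k. y j ^ a j) = (\<Prod>j=1..k. \<Prod>m | m \<in> {1..k} \<and> m \<le> j. z m ^ a j)"
      unfolding y_def prod_power_distrib by (intro prod.cong) auto
    also have "\<dots> = (\<Prod>m=1..k. \<Prod>j | j \<in> {1..k} \<and> m \<le> j. z m ^ a j)"
      by (rule prod.swap_restrict) auto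
    also have "\<dots> = (\<Prod>m=1..k. z m ^ (\<Sum>j=m..k. a j))"
      unfolding power_sum by (intro prod.cong) auto
    finally show ?thesis .
  qed
  have "ennreal (\<Prod>j=1..k. tau (y j)) = (\<Prod>j=1..k. ennreal (tau (y j)))"
    using y by (intro prod_ennreal[symmetric]) (simp add: tau_def less_imp_le)
  also have "\<dots> = (\<Prod>j=1..k. \<integral>\<^sup>+a. ennreal (y j ^ a) \<partial>count_space {1..})"
    using y by (intro prod.cong ennreal_tau_geometric) auto
  also have "\<dots> = (\<integral>\<^sup>+a. (\<Prod>j=1..k. ennreal (y j ^ a j)) \<partial>Pi\<^sub>M {1..k} (\<lambda>_. count_space {1..}))"
    by (intro product_nn_integral_prod[symmetric]) auto
  \<comment> \<open>A finite product of counting measures on countable sets is the counting measure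
    on the product set.\<close>
  also have "\<dots> = (\<integral>\<^sup>+a. ennreal (\<Prod>j=1..k. y j ^ a j) \<partial>count_space ({1..k} \<rightarrow>\<^sub>E {1..}))"
    using y by (subst count_space_PiM_finite) (auto intro!: nn_integral_cong prod_ennreal)
  also have "\<dots> = (\<integral>\<^sup>+a. ennreal (\<Prod>j=1..k. z j ^ (\<lambda>j\<in>{1..k}. \<Sum>m=j..k. a m) j)
                    \<partial>count_space ({1..k} \<rightarrow>\<^sub>E {1..}))"
    unfolding regroup by (intro nn_integral_cong arg_cong[where f = ennreal] prod.cong) auto
  also have "\<dots> = (\<integral>\<^sup>+n. ennreal (\<Prod>j=1..k. z j ^ n j) \<partial>count_space (mpl_indices k))"
    by (rule nn_integral_bij_count_space[OF bij_betw_tail_sums_mpl_indices])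
  finally show ?thesis unfolding y_def .
qed

section \<open>Comparison of the chain weights with \<open>Delta\<close>\<close>

lemma chain_density_prod:
  assumes "chain_density r v \<noteq> 0"
  shows "chain_density r v = (\<Prod>i=1..r. 1 / v i)"
  unfolding chain_density_def
proof (intro prod.cong refl)
  fix i assume "i \<in> {1..r}"
  from chain_density_neq_0D[OF assms this]
  show "(if 0 < v i \<and> v i < chain_bound v (i - 1) then 1 / v i else 0) = 1 / v i" by simp
qed

text \<open>The simplex demands positivity of the last variable only; it passes to all earlier ones
  along the decreasing chain. The condition \<open>1 \<le> r\<close> ensures that \<open>v 1\<close>
  and \<open>v r\<close> belong to the chain.\<close>

lemma chain_density_neq_0_iff:
  assumes "1 \<le> r"
  shows "chain_density r v \<noteq> 0 \<longleftrightarrow>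
           1 > v 1 \<and> (\<forall>i\<in>{1..<r}. v i > v (i + 1)) \<and> v r > 0"
proof
  assume "chain_density r v \<noteq> 0"
  note D = chain_density_neq_0D[OF this]
  have "v (i + 1) < v i" if "i \<in> {1..<r}" for i
    using D[of "i + 1"] that by (simp add: chain_bound_def)
  moreover have "v 1 < 1" "0 < v r"
    using D[of 1] D[of r] assms by (simp_all add: chain_bound_def)
  ultimately show "1 > v 1 \<and> (\<forall>i\<in>{1..<r}. v i > v (i + 1)) \<and> v r > 0"
    by blast
next
  assume *: "1 > v 1 \<and> (\<forall>i\<in>{1..<r}. v i > v (i + 1)) \<and> v r > 0"
  have pos: "0 < v i" if "1 \<le> i" "i \<le> r" for i
    using that(2,1)
  proof (induction rule: inc_induct)
    case base
    show ?case using * by blast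
  next
    case (step i)
    hence "i \<in> {1..<r}" by simp
    hence "v (i + 1) < v i" using * by blast
    thus ?case using step.IH step.prems by simp
  qed
  have less: "v i < chain_bound v (i - 1)" if "i \<in> {1..r}" for i
  proof (cases "i = 1")
    case True
    thus ?thesis using * by (simp add: chain_bound_def)
  next
    case False
    hence "i - 1 \<in> {1..<r}" "i - 1 + 1 = i" "i - 1 \<noteq> 0" using that by auto
    thus ?thesis using * unfolding chain_bound_def by metis
  qed
  have "0 < chain_density r v"
    unfolding chain_density_def
  proof (rule prod_pos)
    fix i assume "i \<in> {1..r}"
    thus "0 < (if 0 < v i \<and> v i < chain_bound v (i - 1) then 1 / v i else 0)"
      using pos[of i] less[of i] by simp
  qed
  thus "chain_density r v \<noteq> 0" by simp
qed

lemma chain_density_neq_0_less_1: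
  assumes "chain_density r v \<noteq> 0" "1 \<le> r"
  shows "v r < 1"
proof -
  have "v i < 1" if "1 \<le> i" "i \<le> r" for i
    using that
  proof (induction i rule: nat_induct_at_least)
    case base
    thus ?case using chain_density_neq_0D[OF assms(1), of 1] by (simp add: chain_bound_def)
  next
    case (Suc i)
    thus ?case using chain_density_neq_0D[OF assms(1), of "Suc i"] by (simp add: chain_bound_def)
  qed
  thus ?thesis using assms by simp
qed

text \<open>This turns the integral over \<open>Delta\<close> into one over the whole space: outside
  \<open>Delta\<close> the weight of at least one chain vanishes. The factors \<open>t j\<close> are
  arbitrary and later hold the values of \<open>tau\<close>.\<close>

lemma indicator_Delta_integrand:
  assumes "\<And>j. j \<in> {1..k} \<Longrightarrow> 1 \<le> s j" "u \<in> mpl_vars k s \<rightarrow>\<^sub>E UNIV"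
  shows "indicator (Delta k s) u * (\<Prod>j=1..k. t j * (\<Prod>r=1..s j. 1 / u (j, r))) =
           (\<Prod>j=1..k. t j * chain_density (s j) (\<lambda>r. u (j, r)))"
proof (cases "u \<in> Delta k s")
  case True
  hence "chain_density (s j) (\<lambda>r. u (j, r)) = (\<Prod>r=1..s j. 1 / u (j, r))" if "j \<in> {1..k}" for j
    using that assms(1)[OF that]
    by (intro chain_density_prod) (auto simp: Delta_def chain_density_neq_0_iff)
  thus ?thesis using True by simp
next
  case False
  then obtain j where "j \<in> {1..k}" and
      "\<not> (1 > u (j, 1) \<and> (\<forall>i\<in>{1..<s j}. u (j, i) > u (j, i + 1)) \<and> u (j, s j) > 0)"
    using assms(2) unfolding Delta_def by blast
  hence "chain_density (s j) (\<lambda>r. u (j, r)) = 0"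
    using chain_density_neq_0_iff[of "s j" "\<lambda>r. u (j, r)"] assms(1) by blast
  hence "\<exists>j\<in>{1..k}. chain_density (s j) (\<lambda>r. u (j, r)) = 0"
    using \<open>j \<in> {1..k}\<close> by blast
  thus ?thesis using False by (auto simp: prod_zero)
qed

section \<open>The nested series as an unordered sum\<close>

lemma finite_mpl_indices_first:
  assumes "1 \<le> k"
  shows "finite {n \<in> mpl_indices k. n 1 = N}"
proof (rule finite_subset)
  show "{n \<in> mpl_indices k. n 1 = N} \<subseteq> {1..k} \<rightarrow>\<^sub>E {..N}"
  proof (clarify)
    fix n assume n: "n \<in> mpl_indices k"
    hence ext: "n \<in> extensional {1..k}"
      and decreasing: "\<forall>i\<in>{1..k}. \<forall>j\<in>{1..k}. i < j \<longrightarrow> n j < n i"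
      unfolding mpl_indices_def PiE_iff by blast+
    have "n j \<le> n 1" if "j \<in> {1..k}" for j
    proof (cases "j = 1")
      case False
      hence "1 \<in> {1..k}" "1 < j" using that assms by auto
      thus ?thesis using decreasing that less_imp_le by blast
    qed simp
    thus "n \<in> {1..k} \<rightarrow>\<^sub>E {..n 1}" using ext by (simp add: PiE_iff)
  qed
qed (intro finite_PiE finite_atLeastAtMost finite_atMost)

text \<open>\<open>Li\<close> groups the tuples by their largest entry \<open>n 1\<close>. The terms
  being nonnegative, this grouping does not change the sum, and convergence of the grouped series
  makes the total finite.\<close>

lemma nn_integral_mpl_indices:
  assumes "1 \<le> k" "\<And>j. j \<in> {1..k} \<Longrightarrow> 0 \<le> x j" "mpl_converges k s x"
  shows "(\<integral>\<^sup>+n. ennreal (\<Prod>j=1..k. x j ^ n j / real (n j) ^ s j) \<partial>count_space (mpl_indices k)) =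
           ennreal (Li k s x)"
proof -
  define h where "h = (\<lambda>n. \<Prod>j=1..k. x j ^ n j / real (n j) ^ s j)"
  have h: "0 \<le> h n" for n unfolding h_def using assms(2) by (intro prod_nonneg) auto
  \<comment> \<open>Each term is written as a series over N whose only possibly nonzero entry is at
    N = \<open>n 1\<close>; exchanging sum and integral then produces the groups.\<close>
  have "(\<integral>\<^sup>+n. ennreal (h n) \<partial>count_space (mpl_indices k)) =
      (\<integral>\<^sup>+n. (\<Sum>N. ennreal (h n) * indicator {n 1} N) \<partial>count_space (mpl_indices k))"
  proof (intro nn_integral_cong)
    fix n :: "nat \<Rightarrow> nat"
    show "ennreal (h n) = (\<Sum>N. ennreal (h n) * indicator {n 1} N)"
      by (subst suminf_finite[of "{n 1}"]) auto
  qed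
  also have "\<dots> = (\<Sum>N. \<integral>\<^sup>+n. ennreal (h n) * indicator {n 1} N \<partial>count_space (mpl_indices k))"
    by (rule nn_integral_suminf) auto
  also have "\<dots> = (\<Sum>N. ennreal (mpl_term k s x N))"
  proof (intro suminf_cong)
    fix N
    have "(\<integral>\<^sup>+n. ennreal (h n) * indicator {n 1} N \<partial>count_space (mpl_indices k)) =
        (\<Sum>n | n \<in> mpl_indices k \<and> n 1 = N. ennreal (h n) * indicator {n 1} N)"
      using finite_mpl_indices_first[OF assms(1)]
      by (intro nn_integral_count_space') auto
    also have "\<dots> = (\<Sum>n | n \<in> mpl_indices k \<and> n 1 = N. ennreal (h n))"
      by (intro sum.cong) auto
    also have "\<dots> = ennreal (mpl_term k s x N)"
      unfolding mpl_term_def h_def[symmetric] using h by (intro sum_ennreal) auto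
    finally show "(\<integral>\<^sup>+n. ennreal (h n) * indicator {n 1} N \<partial>count_space (mpl_indices k)) =
        ennreal (mpl_term k s x N)" .
  qed
  also have "\<dots> = ennreal (Li k s x)"
    unfolding Li_def
  proof (rule suminf_ennreal_eq)
    show "0 \<le> mpl_term k s x N" for N
      unfolding mpl_term_def h_def[symmetric] by (intro sum_nonneg h)
  qed (use assms(3) in \<open>auto simp: mpl_converges_def\<close>)
  finally show ?thesis unfolding h_def .
qed

section \<open>Interchange of sum and integral\<close>

text \<open>Integrability is part of the conclusion because the integral of a non-integrable
  function is 0 by default; without it the equation alone would not show that the integral
  exists.\<close>

theorem mainTheorem1:
  fixes k :: nat and s :: "nat \<Rightarrow> nat" and x :: "nat \<Rightarrow> real"
  assumes "k \<ge> 1"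
    and "\<And>j. j \<in> {1..k} \<Longrightarrow> s j \<ge> 1"
    and "\<And>j. j \<in> {1..k} \<Longrightarrow> 0 \<le> x j \<and> x j \<le> 1"
    and "mpl_converges k s x"
  defines "f \<equiv> (\<lambda>u :: nat \<times> nat \<Rightarrow> real.
      \<Prod>j=1..k. tau (\<Prod>m=1..j. x m * u (m, s m)) * (\<Prod>r=1..s j. 1 / u (j, r)))"
  shows "set_integrable (mpl_lborel k s) (Delta k s) f \<and>
         Li k s x = (LINT u:Delta k s|mpl_lborel k s. f u)"
proof -
  define K where "K = (\<lambda>j u. chain_density (s j) (\<lambda>r. u (j, r)))"
  \<comment> \<open>\<open>h\<close> is the integrand extended by 0 to the whole space, and
    \<open>g n\<close> is the weighted monomial in the last variables that belongs to the index
    tuple \<open>n\<close>.\<close>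
  define h where "h = (\<lambda>u. \<Prod>j=1..k. tau (\<Prod>m=1..j. x m * u (m, s m)) * K j u)"
  define g where "g = (\<lambda>n u. \<Prod>j=1..k. K j u * chain_bound (\<lambda>r. u (j, r)) (s j) ^ n j)"
  let ?M = "mpl_lborel k s"
  have K_nonneg: "0 \<le> K j u" for j u
    unfolding K_def by (rule chain_density_nonneg)
  have space: "space ?M = mpl_vars k s \<rightarrow>\<^sub>E UNIV"
    by (simp add: mpl_lborel_def space_PiM)
  have K_meas: "K j \<in> borel_measurable ?M" if "j \<in> {1..k}" for j
    unfolding K_def mpl_lborel_def using that
    by (intro measurable_chain_density) (auto simp: mpl_vars_def)
  have u_meas: "(\<lambda>u. u (j, s j)) \<in> borel_measurable ?M" if "j \<in> {1..k}" for j
    unfolding mpl_lborel_def using that assms(2)[OF that]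
    by (intro measurable_component_lborel) (auto simp: mpl_vars_def)
  have bound: "chain_bound (\<lambda>r. u (j, r)) (s j) = u (j, s j)" if "j \<in> {1..k}" for u j
    using assms(2)[OF that] by (simp add: chain_bound_def)
  have h_meas: "h \<in> borel_measurable ?M"
    unfolding h_def tau_def
    by (intro borel_measurable_prod borel_measurable_times borel_measurable_divide
        borel_measurable_diff borel_measurable_const K_meas u_meas) auto
  have g_meas: "g n \<in> borel_measurable ?M" for n
    unfolding g_def using bound
    by (auto intro!: borel_measurable_prod borel_measurable_times borel_measurable_power
        K_meas u_meas cong: prod.cong)
  have expansion: "0 \<le> h u" "ennreal (h u) =
      (\<integral>\<^sup>+n. ennreal (\<Prod>j=1..k. x j ^ n j) * ennreal (g n u) \<partial>count_space (mpl_indices k))" for u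
  proof -
    define z where "z = (\<lambda>j. x j * u (j, s j))"
    have h: "h u = (\<Prod>j=1..k. tau (\<Prod>m=1..j. z m)) * (\<Prod>j=1..k. K j u)"
      by (simp add: h_def z_def prod.distrib)
    have g: "ennreal (\<Prod>j=1..k. x j ^ n j) * ennreal (g n u) =
        ennreal (\<Prod>j=1..k. z j ^ n j) * ennreal (\<Prod>j=1..k. K j u)" for n
    proof -
      have "(\<Prod>j=1..k. x j ^ n j) * g n u = (\<Prod>j=1..k. z j ^ n j) * (\<Prod>j=1..k. K j u)"
        unfolding g_def z_def prod.distrib[symmetric]
        by (intro prod.cong) (auto simp: bound power_mult_distrib)
      moreover have "0 \<le> (\<Prod>j=1..k. x j ^ n j)" "0 \<le> (\<Prod>j=1..k. K j u)"
        using assms(3) K_nonneg by (auto intro!: prod_nonneg)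
      ultimately show ?thesis
        by (simp add: ennreal_mult'[symmetric] ennreal_mult''[symmetric])
    qed
    have "0 \<le> h u \<and> ennreal (h u) =
      (\<integral>\<^sup>+n. ennreal (\<Prod>j=1..k. z j ^ n j) * ennreal (\<Prod>j=1..k. K j u) \<partial>count_space (mpl_indices k))"
    \<comment> \<open>Away from the simplices the arguments of \<open>tau\<close> need not lie in
      [0,1), but there a vanishing weight makes both sides 0.\<close>
    proof (cases "\<exists>j\<in>{1..k}. K j u = 0")
      case True
      hence "(\<Prod>j=1..k. K j u) = 0" by (intro prod_zero) auto
      thus ?thesis by (simp only: h) simp
    next
      case False
      have u: "0 < u (j, s j)" "u (j, s j) < 1" if "j \<in> {1..k}" for j
        using False that chain_density_neq_0_less_1[of "s j" "\<lambda>r. u (j, r)"] assms(2)[OF that]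
          chain_density_neq_0D[of "s j" "\<lambda>r. u (j, r)" "s j"]
        by (auto simp: K_def)
      have z: "0 \<le> z j" "z j < 1" if "j \<in> {1..k}" for j
      proof -
        show "0 \<le> z j"
          using u[OF that] assms(3)[OF that] by (simp add: z_def)
        have "z j \<le> u (j, s j)"
          unfolding z_def using u[OF that] assms(3)[OF that] by (intro mult_left_le_one_le) auto
        thus "z j < 1" using u[OF that] by simp
      qed
      \<comment> \<open>Strictness comes from the first factor alone; the remaining product is at
        most 1. This keeps \<open>tau\<close> away from its pole even if some \<open>x j\<close>
        equals 1.\<close>
      have z_prod: "0 \<le> (\<Prod>m=1..j. z m) \<and> (\<Prod>m=1..j. z m) < 1" if "j \<in> {1..k}" for j
      proof -
        have "(\<Prod>m\<in>{1..j} - {1}. z m) \<le> 1" "0 \<le> (\<Prod>m\<in>{1..j} - {1}. z m)"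
          using z that by (fastforce intro!: prod_le_1 prod_nonneg simp: less_imp_le)+
        moreover have "(\<Prod>m=1..j. z m) = z 1 * (\<Prod>m\<in>{1..j} - {1}. z m)"
          using that by (intro prod.remove) auto
        moreover have "0 \<le> z 1" "z 1 < 1" using z[of 1] assms(1) by auto
        ultimately show ?thesis
          using mult_left_le[of "\<Prod>m\<in>{1..j} - {1}. z m" "z 1"] by auto
      qed
      have "0 \<le> (\<Prod>j=1..k. tau (\<Prod>m=1..j. z m))"
        using z_prod by (intro prod_nonneg) (simp add: tau_def less_imp_le)
      moreover have "0 \<le> (\<Prod>j=1..k. K j u)"
        using K_nonneg by (intro prod_nonneg) auto
      ultimately show ?thesis
        using prod_tau_expansion[of k z] z z_prod
        by (simp add: h ennreal_mult nn_integral_multc)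
    qed
    thus "0 \<le> h u" "ennreal (h u) =
      (\<integral>\<^sup>+n. ennreal (\<Prod>j=1..k. x j ^ n j) * ennreal (g n u) \<partial>count_space (mpl_indices k))"
      unfolding g by auto
  qed
  have Li_nonneg: "0 \<le> Li k s x"
    unfolding Li_def using assms(3,4)
    by (intro suminf_nonneg) (auto simp: mpl_converges_def mpl_term_def intro!: sum_nonneg prod_nonneg)
  \<comment> \<open>Tonelli for a counting measure, which rests on the countability of
    \<open>mpl_indices k\<close>.\<close>
  have "(\<integral>\<^sup>+u. ennreal (h u) \<partial>?M) = (\<integral>\<^sup>+n. (\<integral>\<^sup>+u. ennreal (\<Prod>j=1..k. x j ^ n j) * ennreal (g n u) \<partial>?M)
      \<partial>count_space (mpl_indices k))"
    unfolding expansion(2) using g_meas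
    by (intro nn_integral_count_space_nn_integral countable_mpl_indices) auto
  also have "\<dots> = (\<integral>\<^sup>+n. ennreal (\<Prod>j=1..k. x j ^ n j / real (n j) ^ s j) \<partial>count_space (mpl_indices k))"
  proof (intro nn_integral_cong)
    fix n assume "n \<in> space (count_space (mpl_indices k))"
    hence n: "1 \<le> n j" if "j \<in> {1..k}" for j
      using that by (auto simp: mpl_indices_def)
    have "(\<integral>\<^sup>+u. ennreal (\<Prod>j=1..k. x j ^ n j) * ennreal (g n u) \<partial>?M) =
        ennreal (\<Prod>j=1..k. x j ^ n j) * ennreal (\<Prod>j=1..k. 1 / real (n j) ^ s j)"
      using g_meas[of n] nn_integral_chains[of k n s, OF n]
      by (subst nn_integral_cmult) (auto simp: g_def K_def)
    also have "\<dots> = ennreal (\<Prod>j=1..k. x j ^ n j / real (n j) ^ s j)"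
      by (subst ennreal_mult''[symmetric]) (auto intro!: prod_nonneg simp: prod.distrib[symmetric])
    finally show "(\<integral>\<^sup>+u. ennreal (\<Prod>j=1..k. x j ^ n j) * ennreal (g n u) \<partial>?M) =
        ennreal (\<Prod>j=1..k. x j ^ n j / real (n j) ^ s j)" .
  qed
  also have "\<dots> = ennreal (Li k s x)"
    using assms by (intro nn_integral_mpl_indices) auto
  \<comment> \<open>For a nonnegative measurable function a finite nonnegative integral yields both
    integrability and the value.\<close>
  finally have "integrable ?M h \<and> integral\<^sup>L ?M h = Li k s x"
    using nn_integral_eq_integrable[OF h_meas _ Li_nonneg] expansion(1) by simp
  \<comment> \<open>The restriction to the space matters: \<open>Delta\<close> contains extensional
    functions only, whereas \<open>h\<close> does not see values outside
    \<open>mpl_vars k s\<close>.\<close>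
  moreover have "indicator (Delta k s) u *\<^sub>R f u = h u" if "u \<in> space ?M" for u
    unfolding f_def h_def K_def real_scaleR_def
    using assms(2) that unfolding space by (rule indicator_Delta_integrand)
  ultimately show ?thesis
    unfolding set_integrable_def set_lebesgue_integral_def
    by (simp cong: Bochner_Integration.integrable_cong Bochner_Integration.integral_cong)
qed

end
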